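(* Let $a\ge 1$ and $0\le b\le a$ be integers with $a\equiv b\pmod 2$, let $\sigma\in\{\text{sink},\text{source}\}$ (with $\sigma=\text{sink}$ when $b=0$), let $n=a+b$, and let $k=\frac{a-b}{2}$ if $\sigma=\text{sink}$ and $k=\frac{a+b}{2}$ if $\sigma=\text{source}$. The number of coincidences (perfect matchings) of the experiment graph $\mathtt{G}(a,b,\sigma)$ is $$M(a,b)=\frac{a!}{\bigl(\frac{a-b}{2}\bigr)!}=\binom{a}{k}\Bigl(\frac n2\Bigr)!,$$ regardless of the choice of $\sigma$.
   Context: A coincidence of a multigraph is a perfect matching, i.e. a set of edges covering every vertex exactly once; parallel edges are distinct, so matchings using different parallel edges are different. Edges are called crystals, vertices are called paths, and each of the two arms (edge–endpoint incidences) of a crystal is colored excited ($1$) or ground ($0$). The experiment graph $\mathtt{G}(a,b,\sigma)$: its vertex set is the disjoint union $A\sqcup B$ with $|A|=a$ (signal paths) and $|B|=b$ (spectator paths). For each pair $\{i,j\}\subseteq A$ with $i\ne j$ there are exactly two parallel crystals, one excited at $i$ and ground at $j$, the other ground at $i$ and excited at $j$. There are no crystals between two vertices of $B$. Each $v\in B$ is joined to each $i\in A$ by a single crystal, which is ground at both $i$ and $v$ if $\sigma=\text{sink}$, and excited at $i$ and ground at $v$ if $\sigma=\text{source}$. *)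

theory Defs
  imports Complex_Main "HOL-Number_Theory.Cong"
begin

datatype color = Ground | Excited

(* A crystal has an identity of its own, so parallel crystals are distinct.  Its arms are
   given by a finite map from its endpoints to colors, which suffices for loopless graphs. *)
record ('v, 'e) multigraph =
  paths :: "'v set"
  crystals :: "'e set"
  arms :: "'e \<Rightarrow> 'v \<rightharpoonup> color"

definition ends :: "('v, 'e) multigraph \<Rightarrow> 'e \<Rightarrow> 'v set" where
  "ends G e = dom (arms G e)"

definition wf_multigraph :: "('v, 'e) multigraph \<Rightarrow> bool" where
  "wf_multigraph G \<longleftrightarrow> finite (paths G) \<and> finite (crystals G) \<and>
     (\<forall>e\<in>crystals G. ends G e \<subseteq> paths G \<and> card (ends G e) = 2)"

definition coincidence :: "('v, 'e) multigraph \<Rightarrow> 'e set \<Rightarrow> bool" where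
  "coincidence G M \<longleftrightarrow> M \<subseteq> crystals G \<and> (\<forall>v\<in>paths G. \<exists>!e. e \<in> M \<and> v \<in> ends G e)"

datatype port = Sink | Source

(* Signal i j is the crystal on {i, j} excited at i and ground at j; its parallel partner
   is Signal j i.  Spectator v i is the single crystal joining v in B to i in A. *)
datatype ('s, 't) crystal = Signal 's 's | Spectator 't 's

fun crystal_arms :: "port \<Rightarrow> ('s, 't) crystal \<Rightarrow> 's + 't \<rightharpoonup> color" where
  "crystal_arms \<sigma> (Signal i j) = [Inl i \<mapsto> Excited, Inl j \<mapsto> Ground]"
| "crystal_arms Sink (Spectator v i) = [Inl i \<mapsto> Ground, Inr v \<mapsto> Ground]"
| "crystal_arms Source (Spectator v i) = [Inl i \<mapsto> Excited, Inr v \<mapsto> Ground]"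

definition experiment_graph ::
  "'s set \<Rightarrow> 't set \<Rightarrow> port \<Rightarrow> ('s + 't, ('s, 't) crystal) multigraph" where
  "experiment_graph A B \<sigma> =
     \<lparr> paths = A <+> B,
       crystals = {Signal i j | i j. i \<in> A \<and> j \<in> A \<and> i \<noteq> j} \<union>
                  {Spectator v i | v i. v \<in> B \<and> i \<in> A},
       arms = crystal_arms \<sigma> \<rparr>"

lemma wf_experiment_graph:
  assumes "finite A" "finite B"
  shows "wf_multigraph (experiment_graph A B \<sigma>)"
proof -
  have "crystals (experiment_graph A B \<sigma>) \<subseteq>
      (\<lambda>(i, j). Signal i j) ` (A \<times> A) \<union> (\<lambda>(v, i). Spectator v i) ` (B \<times> A)"
    by (auto simp: experiment_graph_def)
  then have "finite (crystals (experiment_graph A B \<sigma>))"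
    using assms by (auto elim: finite_subset)
  then show ?thesis
    using assms by (cases \<sigma>) (auto simp: wf_multigraph_def experiment_graph_def ends_def split: if_splits)
qed

end

(* Expanding along the crystal that covers a fixed path gives recursions for the number of
   coincidences.  A spectator path has one choice for each signal path, and without spectators
   a signal path has two choices for each other signal path; hence M(a, b) = a M(a - 1, b - 1)
   and M(2m, 0) = 2 (2m - 1) M(2m - 2, 0), which solve to a! / ((a - b) / 2)!. *)
theory Submission imports Defs begin

text \<open>This is not edge contraction: the endpoints of \<open>e\<close> are deleted together
  with every crystal touching them. The arms are left as they are, so \<open>ends\<close> remains
  the same function.\<close>

definition contract :: "('v, 'e) multigraph \<Rightarrow> 'e \<Rightarrow> ('v, 'e) multigraph" where
  "contract G e = \<lparr> paths = paths G - ends G e,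
     crystals = {f \<in> crystals G. ends G f \<inter> ends G e = {}}, arms = arms G \<rparr>"

lemma ends_contract [simp]: "ends (contract G e) = ends G"
  by (simp add: fun_eq_iff ends_def contract_def)

lemma coincidence_insert_contract:
  assumes "e \<in> crystals G" "coincidence (contract G e) M"
  shows "coincidence G (insert e M)"
proof -
  have sub: "M \<subseteq> crystals G" "\<And>f. f \<in> M \<Longrightarrow> ends G f \<inter> ends G e = {}"
    using assms(2) by (auto simp: coincidence_def contract_def)
  have uni: "\<exists>!f. f \<in> M \<and> v \<in> ends G f" if "v \<in> paths G" "v \<notin> ends G e" for v
    using assms(2) that unfolding coincidence_def ends_contract by (simp add: contract_def)
  have "\<exists>!f. f \<in> insert e M \<and> v \<in> ends G f" if v: "v \<in> paths G" for v
  proof (cases "v \<in> ends G e")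
    case True
    then show ?thesis using sub(2) by blast
  next
    case False
    then show ?thesis using uni[OF v False] by blast
  qed
  then show ?thesis using sub(1) assms(1) by (auto simp: coincidence_def)
qed

text \<open>Another crystal of \<open>M\<close> meeting \<open>e\<close> would cover a common
  endpoint a second time; well-formedness makes that endpoint a path, where uniqueness
  applies.\<close>

lemma coincidence_contract_remove:
  assumes "wf_multigraph G" "coincidence G M" "e \<in> M"
  shows "coincidence (contract G e) (M - {e})"
proof -
  have sub: "M \<subseteq> crystals G"
    and uni: "\<And>v. v \<in> paths G \<Longrightarrow> \<exists>!f. f \<in> M \<and> v \<in> ends G f"
    using assms(2) by (auto simp: coincidence_def)
  have "ends G e \<subseteq> paths G"
    using assms(1,3) sub by (auto simp: wf_multigraph_def)
  then have "ends G f \<inter> ends G e = {}" if "f \<in> M - {e}" for f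
    using uni assms(3) that by blast
  moreover have "\<exists>!f. f \<in> M - {e} \<and> v \<in> ends G f" if "v \<in> paths G" "v \<notin> ends G e" for v
    using uni[OF that(1)] that(2) by blast
  ultimately show ?thesis
    using sub unfolding coincidence_def ends_contract by (auto simp: contract_def)
qed

text \<open>Each coincidence is classified by the unique crystal \<open>e\<close> covering
  \<open>x\<close>; removing \<open>e\<close> and inserting it again gives a bijection with the
  coincidences of \<open>contract G e\<close>.\<close>

lemma card_coincidence_expand:
  assumes wf: "wf_multigraph G" and x: "x \<in> paths G"
  shows "card {M. coincidence G M} =
    (\<Sum>e \<in> {e \<in> crystals G. x \<in> ends G e}. card {M. coincidence (contract G e) M})"
proof -
  let ?E = "{e \<in> crystals G. x \<in> ends G e}"
  let ?C = "\<lambda>e. {M. coincidence (contract G e) M}"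
  have fin: "finite (crystals G)" using wf by (simp add: wf_multigraph_def)
  have finC: "finite (?C e)" for e
    by (rule finite_subset[of _ "Pow (crystals G)"])
      (auto simp: coincidence_def contract_def fin)
  have "{M. coincidence G M} = (\<Union>e \<in> ?E. insert e ` ?C e)"
  proof (intro subset_antisym subsetI)
    fix M assume "M \<in> {M. coincidence G M}"
    then have M: "coincidence G M" by simp
    then obtain e where e: "e \<in> M" "x \<in> ends G e" "e \<in> crystals G"
      using x unfolding coincidence_def by blast
    then have "M - {e} \<in> ?C e" "M = insert e (M - {e})"
      using coincidence_contract_remove[OF wf M] by auto
    then show "M \<in> (\<Union>e \<in> ?E. insert e ` ?C e)" using e by blast
  qed (auto intro: coincidence_insert_contract)
  also have "card \<dots> = (\<Sum>e \<in> ?E. card (insert e ` ?C e))"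
  proof (rule card_UN_disjoint)
    show "\<forall>e\<in>?E. \<forall>f\<in>?E. e \<noteq> f \<longrightarrow> insert e ` ?C e \<inter> insert f ` ?C f = {}"
    proof (intro ballI impI)
      fix e f assume ef: "e \<in> ?E" "f \<in> ?E" "e \<noteq> f"
      \<comment> \<open>Both crystals contain \<open>x\<close>, so \<open>f\<close> does not survive
        in \<open>contract G e\<close>.\<close>
      have "f \<notin> insert e M" if "M \<in> ?C e" for M
        using that ef by (auto simp: coincidence_def contract_def)
      then show "insert e ` ?C e \<inter> insert f ` ?C f = {}" by blast
    qed
  qed (use fin finC in auto)
  also have "\<dots> = (\<Sum>e \<in> ?E. card (?C e))"
  proof (rule sum.cong[OF refl])
    fix e assume "e \<in> ?E"
    \<comment> \<open>Since \<open>x\<close> lies on \<open>e\<close>, the crystal \<open>e\<close>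
      meets itself and is dropped by the contraction; hence inserting \<open>e\<close> is
      injective.\<close>
    then have "e \<notin> M" if "M \<in> ?C e" for M
      using that by (auto simp: coincidence_def contract_def)
    then show "card (insert e ` ?C e) = card (?C e)"
      by (intro card_image inj_onI) (metis insert_ident)
  qed
  finally show ?thesis .
qed

lemma experiment_graph_simps [simp]:
  "paths (experiment_graph A B \<sigma>) = A <+> B"
  "crystals (experiment_graph A B \<sigma>) =
    {Signal i j | i j. i \<in> A \<and> j \<in> A \<and> i \<noteq> j} \<union> {Spectator v i | v i. v \<in> B \<and> i \<in> A}"
  "arms (experiment_graph A B \<sigma>) = crystal_arms \<sigma>"
  by (simp_all add: experiment_graph_def)

lemma ends_experiment_graph [simp]:
  "ends (experiment_graph A B \<sigma>) (Signal i j) = {Inl i, Inl j}"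
  "ends (experiment_graph A B \<sigma>) (Spectator v i) = {Inl i, Inr v}"
  by (cases \<sigma>; auto simp: ends_def)+

text \<open>The family of experiment graphs is closed under \<open>contract\<close>, which turns the
  expansion into a recursion. The records are literally equal because \<open>crystal_arms\<close>
  depends only on the port, not on \<open>A\<close> and \<open>B\<close>.\<close>

lemma contract_Spectator:
  "contract (experiment_graph A B \<sigma>) (Spectator v i) = experiment_graph (A - {i}) (B - {v}) \<sigma>"
  by (rule multigraph.equality) (auto simp: contract_def)

lemma contract_Signal:
  "contract (experiment_graph A B \<sigma>) (Signal i j) = experiment_graph (A - {i, j}) B \<sigma>"
  by (rule multigraph.equality) (auto simp: contract_def)

lemma card_coincidence_Spectator:
  assumes "finite A" "finite B" "v \<in> B"
  shows "card {M. coincidence (experiment_graph A B \<sigma>) M} =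
    (\<Sum>i\<in>A. card {M. coincidence (experiment_graph (A - {i}) (B - {v}) \<sigma>) M})"
proof -
  let ?G = "experiment_graph A B \<sigma>"
  have E: "{e \<in> crystals ?G. Inr v \<in> ends ?G e} = Spectator v ` A"
    using assms(3) by auto
  have "Inr v \<in> paths ?G" using assms(3) by auto
  then have "card {M. coincidence ?G M} =
      (\<Sum>e\<in>Spectator v ` A. card {M. coincidence (contract ?G e) M})"
    using card_coincidence_expand[OF wf_experiment_graph[OF assms(1,2)], of "Inr v" \<sigma>]
    by (simp only: E)
  then show ?thesis
    by (simp add: sum.reindex inj_on_def contract_Spectator)
qed

text \<open>The two parallel crystals between \<open>i\<close> and \<open>j\<close> leave the same
  graph behind, hence the factor 2.\<close>

lemma card_coincidence_Signal:
  assumes "finite A" "i \<in> A"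
  shows "card {M. coincidence (experiment_graph A ({} :: 't set) \<sigma>) M} =
    (\<Sum>j\<in>A - {i}.
      2 * card {M. coincidence (experiment_graph (A - {i, j}) ({} :: 't set) \<sigma>) M})"
proof -
  let ?G = "experiment_graph A ({} :: 't set) \<sigma>"
  let ?c = "\<lambda>e. card {M. coincidence (contract ?G e) M}"
  have E: "{e \<in> crystals ?G. Inl i \<in> ends ?G e} =
      Signal i ` (A - {i}) \<union> (\<lambda>j. Signal j i) ` (A - {i})"
    using assms(2) by auto
  have "Inl i \<in> paths ?G" using assms(2) by auto
  then have "card {M. coincidence ?G M} =
      sum ?c (Signal i ` (A - {i}) \<union> (\<lambda>j. Signal j i) ` (A - {i}))"
    by (simp only: card_coincidence_expand[OF wf_experiment_graph[OF assms(1) finite.emptyI]] E)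
  also have "\<dots> = sum ?c (Signal i ` (A - {i})) + sum ?c ((\<lambda>j. Signal j i) ` (A - {i}))"
    \<comment> \<open>The two families are disjoint because \<open>Signal i j\<close> and
      \<open>Signal j i\<close> differ for \<open>j\<close> other than \<open>i\<close>.\<close>
    using assms(1) by (intro sum.union_disjoint) auto
  also have "\<dots> = (\<Sum>j\<in>A - {i}.
      2 * card {M. coincidence (experiment_graph (A - {i, j}) ({} :: 't set) \<sigma>) M})"
    by (simp add: sum.reindex inj_on_def contract_Signal insert_commute mult_2 sum.distrib)
  finally show ?thesis .
qed

text \<open>Multiplying by \<open>fact m\<close> avoids a division and keeps the induction in the
  natural numbers.\<close>

lemma card_coincidence_no_spectators:
  assumes "finite A" "card A = 2 * m"
  shows "card {M. coincidence (experiment_graph A ({} :: 't set) \<sigma>) M} * fact m = fact (2 * m)"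
  using assms
proof (induction m arbitrary: A)
  case 0
  \<comment> \<open>With no paths and no crystals, the empty set is the one coincidence.\<close>
  then have "coincidence (experiment_graph A ({} :: 't set) \<sigma>) = (\<lambda>M. M = {})"
    by (auto simp: coincidence_def)
  then show ?case by simp
next
  case (Suc m)
  then obtain i where i: "i \<in> A" by fastforce
  let ?c = "\<lambda>j. card {M. coincidence (experiment_graph (A - {i, j}) ({} :: 't set) \<sigma>) M}"
  have "?c j * fact m = fact (2 * m)" if "j \<in> A - {i}" for j
    using Suc that i by (intro Suc.IH) (auto simp: card_Diff_subset)
  then have "(\<Sum>j\<in>A - {i}. 2 * ?c j * fact m) = (\<Sum>j\<in>A - {i}. 2 * fact (2 * m))"
    by (intro sum.cong) (auto simp: mult.assoc)
  also have "\<dots> = (2 * m + 1) * (2 * fact (2 * m))"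
    using Suc.prems i by simp
  finally have "card {M. coincidence (experiment_graph A ({} :: 't set) \<sigma>) M} * fact m =
      (2 * m + 1) * (2 * fact (2 * m))"
    by (simp only: card_coincidence_Signal[OF Suc.prems(1) i] sum_distrib_right)
  \<comment> \<open>The factor \<open>m + 1\<close> completes \<open>fact m\<close> to
    \<open>fact (Suc m)\<close> on the left, and on the right 2 (m + 1) is the missing factor 2m + 2
    of \<open>fact (2 * Suc m)\<close>.\<close>
  then have "card {M. coincidence (experiment_graph A ({} :: 't set) \<sigma>) M} * fact m * (m + 1) =
      (2 * m + 1) * (2 * fact (2 * m)) * (m + 1)" by simp
  then show ?case by (simp add: algebra_simps)
qed

text \<open>Matching a spectator path uses up one signal path, so \<open>m\<close> stays fixed while
  \<open>B\<close> shrinks; each such step contributes the factor \<open>card A\<close>, until no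
  spectators remain.\<close>

lemma card_coincidence_experiment_graph:
  assumes "finite B" "finite A" "card A = card B + 2 * m"
  shows "card {M. coincidence (experiment_graph A B \<sigma>) M} * fact m = fact (card A)"
  using assms
proof (induction B arbitrary: A rule: finite_induct)
  case empty
  then show ?case using card_coincidence_no_spectators[of A m \<sigma>] by simp
next
  case (insert v B)
  let ?c = "\<lambda>i. card {M. coincidence (experiment_graph (A - {i}) B \<sigma>) M}"
  have card: "card A = Suc (card B + 2 * m)" using insert by simp
  have "?c i * fact m = fact (card B + 2 * m)" if "i \<in> A" for i
    using insert.IH[of "A - {i}"] insert.prems(1) card that by simp
  then have "(\<Sum>i\<in>A. ?c i * fact m) = card A * fact (card B + 2 * m)"
    by simp
  then show ?case
    using card_coincidence_Spectator[OF insert.prems(1), of "insert v B" v \<sigma>] insert.hyps card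
    by (simp add: sum_distrib_right)
qed

theorem mainTheorem2:
  fixes A :: "'s set" and B :: "'t set" and a b n k :: nat and \<sigma> :: port
  assumes "finite A" and "card A = a"
    and "finite B" and "card B = b"
    and "a \<ge> 1" and "b \<le> a" and "[a = b] (mod 2)"
    and "b = 0 \<longrightarrow> \<sigma> = Sink"
    and "n = a + b"
    and "k = (case \<sigma> of Sink \<Rightarrow> (a - b) div 2 | Source \<Rightarrow> (a + b) div 2)"
  shows "real (card {M. coincidence (experiment_graph A B \<sigma>) M}) = fact a / fact ((a - b) div 2)
    \<and> fact a / fact ((a - b) div 2) = real (a choose k) * fact (n div 2)"
proof -
  have "even (a - b)"
    using \<open>[a = b] (mod 2)\<close> \<open>b \<le> a\<close> by (metis cong_altdef_nat cong_sym)
  then obtain m where "a - b = 2 * m" by (elim evenE)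
  then have a: "a = b + 2 * m" using \<open>b \<le> a\<close> by simp
  have "real (card {M. coincidence (experiment_graph A B \<sigma>) M} * fact m) = real (fact a)"
    using card_coincidence_experiment_graph[of B A m \<sigma>] assms(1-4) a by simp
  then have "real (card {M. coincidence (experiment_graph A B \<sigma>) M}) = fact a / fact m"
    by (simp add: field_simps)
  \<comment> \<open>Here k is m for \<open>Sink\<close> and b + m for \<open>Source\<close>. These
    sum to a, so both binomials equal a! / (m! (b + m)!), and b + m is also n / 2.\<close>
  moreover have "fact a / fact m = real (a choose k) * fact (n div 2)"
    using assms(9,10) a by (cases \<sigma>) (simp_all add: binomial_fact add.commute)
  ultimately show ?thesis using a by simp
qed

end
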